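(* A finite graph $G$ is a Zykov graph if and only if every induced subgraph of $G$ contains a non-empty splitting stable set.
   Context: Zykov's construction: $Z_1$ is the graph with one vertex. Given $Z_1,\dots,Z_k$ ($k\ge 1$), the graph $Z_{k+1}$ is obtained by taking the disjoint union of $Z_1,\dots,Z_k$ and, for each $k$-tuple $(v_1,\dots,v_k)$ with $v_i\in V(Z_i)$, adding a new vertex adjacent exactly to $v_1,\dots,v_k$. A Zykov graph is any graph isomorphic to an induced subgraph of $Z_k$ for some integer $k\ge 1$. A stable set $A$ of a graph $G$ is splitting if every vertex of $A$ has at most one neighbor in each connected component of $G\setminus A$ (the graph obtained by deleting $A$). Here "induced subgraph" means induced subgraph on a non-empty vertex set. *)

theory Defs
  imports "Graph_Theory.Graph_Theory"
begin

(* Finite simple graphs are the library's locale graph: finite symmetric digraphs without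
   loops and without parallel arcs; u -- v is an edge iff (u, v) is in arcs_ends G. *)

section \<open>Zykov's construction\<close>

(* All the graphs Z_k live on one vertex type.  Copy i v is the vertex v of the i-th graph in the
   disjoint union; Apex [v_1, ..., v_k] is the new vertex added for the tuple (v_1, ..., v_k). *)
datatype zvertex = Copy nat zvertex | Apex "zvertex list"

definition zykov_tuples :: "nat \<Rightarrow> (nat \<Rightarrow> zvertex pair_pre_digraph) \<Rightarrow> zvertex list set" where
  "zykov_tuples k Z = {vs. length vs = k \<and> (\<forall>i\<in>{1..k}. vs ! (i - 1) \<in> pverts (Z i))}"

definition zykov_step :: "nat \<Rightarrow> (nat \<Rightarrow> zvertex pair_pre_digraph) \<Rightarrow> zvertex pair_pre_digraph" where
  "zykov_step k Z = \<lparr>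
     pverts = (\<Union>i\<in>{1..k}. Copy i ` pverts (Z i)) \<union> Apex ` zykov_tuples k Z,
     parcs = (\<Union>i\<in>{1..k}. {(Copy i u, Copy i v) | u v. (u, v) \<in> parcs (Z i)})
       \<union> (\<Union>vs\<in>zykov_tuples k Z. \<Union>i\<in>{1..k}.
           {(Apex vs, Copy i (vs ! (i - 1))), (Copy i (vs ! (i - 1)), Apex vs)}) \<rparr>"

(* Needed for the termination proof of the course-of-values recursion below. *)
lemma zykov_step_cong [fundef_cong]:
  assumes "k = k'" "\<And>i. i \<in> {1..k'} \<Longrightarrow> Z i = Z' i"
  shows "zykov_step k Z = zykov_step k' Z'"
proof -
  have "zykov_tuples k Z = zykov_tuples k' Z'"
    using assms by (simp add: zykov_tuples_def)
  then show ?thesis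
    using assms by (simp add: zykov_step_def)
qed

(* The construction starts at k = 1; the value at 0 is a dummy that is never used. *)
fun zykov :: "nat \<Rightarrow> zvertex pair_pre_digraph" where
  "zykov 0 = \<lparr> pverts = {}, parcs = {} \<rparr>"
| "zykov (Suc 0) = \<lparr> pverts = {Apex []}, parcs = {} \<rparr>"
| "zykov (Suc (Suc k)) = zykov_step (Suc k) (\<lambda>i. zykov i)"

definition is_zykov_graph :: "('a, 'b) pre_digraph \<Rightarrow> bool" where
  "is_zykov_graph G \<longleftrightarrow>
     (\<exists>k\<ge>1. \<exists>H. induced_subgraph H (with_proj (zykov k)) \<and> verts H \<noteq> {} \<and> digraph_iso G H)"

(* induced_subgraph H G entails well-formedness of G, so is_zykov_graph is only meaningful
   because every zykov k is well-formed; pair_graph_zykov below shows it is a finite simple graph. *)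
lemma finite_zykov_tuples:
  assumes "\<And>i. i \<in> {1..k} \<Longrightarrow> finite (pverts (Z i))"
  shows "finite (zykov_tuples k Z)"
proof (rule finite_subset)
  show "zykov_tuples k Z
      \<subseteq> {vs. set vs \<subseteq> (\<Union>i\<in>{1..k}. pverts (Z i)) \<and> length vs = k}"
  proof (safe)
    fix vs v assume vs: "vs \<in> zykov_tuples k Z" and "v \<in> set vs"
    then obtain j where j: "j < k" "v = vs ! j"
      by (auto simp: zykov_tuples_def in_set_conv_nth)
    with vs have "v \<in> pverts (Z (Suc j))"
      by (auto simp: zykov_tuples_def dest!: bspec[where x = "Suc j"])
    with j show "v \<in> (\<Union>i\<in>{1..k}. pverts (Z i))" by force
  qed (simp add: zykov_tuples_def)
qed (use assms in \<open>simp add: finite_lists_length_eq\<close>)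

lemma Copy_in_zykov_step: "Copy i v \<in> pverts (zykov_step k Z) \<longleftrightarrow> i \<in> {1..k} \<and> v \<in> pverts (Z i)"
  and Apex_in_zykov_step: "Apex vs \<in> pverts (zykov_step k Z) \<longleftrightarrow> vs \<in> zykov_tuples k Z"
  unfolding zykov_step_def by auto

lemma pair_graph_zykov_step:
  assumes "\<And>i. i \<in> {1..k} \<Longrightarrow> pair_graph (Z i)"
  shows "pair_graph (zykov_step k Z)"
proof -
  have fin: "finite (pverts (Z i))" if "i \<in> {1..k}" for i
    using assms[OF that] by (simp add: pair_fin_digraph.pair_finite_verts pair_graph_def pair_digraph_def)
  have wf: "u \<in> pverts (Z i)" "v \<in> pverts (Z i)" if "i \<in> {1..k}" "(u, v) \<in> parcs (Z i)" for i u v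
    using assms[OF that(1)] that(2) pair_wf_digraph.wellformed'
    by (metis pair_digraph.pair_wf_digraph pair_graph_def)+
  have sym: "(v, u) \<in> parcs (Z i)" if "i \<in> {1..k}" "(u, v) \<in> parcs (Z i)" for i u v
    using assms[OF that(1)] that(2)
    by (metis pair_graph.axioms(2) pair_pseudo_graph_def pair_sym_digraph.arcs_symmetric)
  have irr: "(u, u) \<notin> parcs (Z i)" if "i \<in> {1..k}" for i u
    using assms[OF that] pair_loopfree_digraph.no_loops'
    by (metis pair_digraph_def pair_graph_def)
  let ?Z = "zykov_step k Z"
  have wfZ: "fst e \<in> pverts ?Z \<and> snd e \<in> pverts ?Z" if "e \<in> parcs ?Z" for e
  proof -
    from that consider
        i u v where "i \<in> {1..k}" "(u, v) \<in> parcs (Z i)" "e = (Copy i u, Copy i v)"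
      | i vs where "i \<in> {1..k}" "vs \<in> zykov_tuples k Z"
          "e = (Apex vs, Copy i (vs ! (i - 1))) \<or> e = (Copy i (vs ! (i - 1)), Apex vs)"
      unfolding zykov_step_def by auto
    then show ?thesis
    proof cases
      case 1
      with wf show ?thesis by (simp add: Copy_in_zykov_step)
    next
      case 2
      then have "vs ! (i - 1) \<in> pverts (Z i)" by (simp add: zykov_tuples_def)
      with 2 show ?thesis by (auto simp: Copy_in_zykov_step Apex_in_zykov_step)
    qed
  qed
  have finZ: "finite (pverts ?Z)"
    using fin finite_zykov_tuples[of k Z] by (auto simp: zykov_step_def)
  have "finite (parcs ?Z)"
  proof (rule finite_subset)
    show "parcs ?Z \<subseteq> pverts ?Z \<times> pverts ?Z"
      using wfZ by (simp add: subset_iff mem_Times_iff del: split_paired_All)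
  qed (use finZ in simp)
  moreover have "symmetric (with_proj ?Z)"
    unfolding symmetric_def with_proj_simps
  proof (rule symI)
    fix u v assume "(u, v) \<in> parcs ?Z"
    then consider
        i u' v' where "i \<in> {1..k}" "(u', v') \<in> parcs (Z i)" "u = Copy i u'" "v = Copy i v'"
      | i vs where "i \<in> {1..k}" "vs \<in> zykov_tuples k Z"
          "(v, u) \<in> {(Apex vs, Copy i (vs ! (i - 1))), (Copy i (vs ! (i - 1)), Apex vs)}"
      unfolding zykov_step_def by auto
    then show "(v, u) \<in> parcs ?Z"
    proof cases
      case 1
      with sym[OF 1(1,2)] show ?thesis unfolding zykov_step_def by auto
    next
      case 2
      then show ?thesis
        unfolding zykov_step_def pair_pre_digraph.simps by blast
    qed
  qed
  moreover have "fst e \<noteq> snd e" if "e \<in> parcs ?Z" for e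
    using that irr by (auto simp: zykov_step_def)
  ultimately show ?thesis
    by unfold_locales (simp_all add: wfZ finZ)
qed

lemma pair_graph_zykov: "pair_graph (zykov k)"
proof (induction k rule: zykov.induct)
  case (3 k)
  then show ?case
    by (simp only: zykov.simps) (rule pair_graph_zykov_step; auto)
qed (unfold_locales; auto simp: symmetric_def sym_def)+


section \<open>Splitting stable sets\<close>

definition stable_set :: "('a, 'b) pre_digraph \<Rightarrow> 'a set \<Rightarrow> bool" where
  "stable_set G A \<longleftrightarrow> A \<subseteq> verts G \<and> (\<forall>u\<in>A. \<forall>v\<in>A. (u, v) \<notin> arcs_ends G)"

(* In a symmetric digraph the strongly connected components, sccs, are exactly the connected
   components; G \<restriction> (verts G - A) is the graph obtained by deleting A. *)
definition splitting_stable_set :: "('a, 'b) pre_digraph \<Rightarrow> 'a set \<Rightarrow> bool" where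
  "splitting_stable_set G A \<longleftrightarrow> stable_set G A \<and>
     (\<forall>a\<in>A. \<forall>C\<in>pre_digraph.sccs (G \<restriction> (verts G - A)).
        \<forall>u\<in>verts C. \<forall>v\<in>verts C. (a, u) \<in> arcs_ends G \<and> (a, v) \<in> arcs_ends G \<longrightarrow> u = v)"

end

(* A splitting set of an induced subgraph of Z_k is its set of apices, if there are any; otherwise
   the subgraph lives in the copies of Z_1, ..., Z_{k-1}, and induction gives one inside a single
   copy.  Conversely, delete a splitting set A, embed the components of the rest into distinct Z_i,
   and turn every vertex of A into the apex of a tuple: its coordinate at a component is its only
   neighbour there, or a vertex outside the image of the component if it has none. *)
theory Submission
  imports Defs
begin

section \<open>Splitting sets of a relation\<close>

text \<open>Splitting stable sets on a bare relation, so that vertex subsets of \<open>G\<close> and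
  of \<open>zykov k\<close> are treated alike. A component of \<open>S - A\<close> is encoded by
  reachability inside \<open>S - A\<close>; \<open>u \<in> S - A\<close> excludes reflexive pairs
  elsewhere and forces \<open>v\<close> into \<open>S - A\<close> too.\<close>

definition splitting :: "'a rel \<Rightarrow> 'a set \<Rightarrow> 'a set \<Rightarrow> bool" where
  "splitting E S A \<longleftrightarrow> A \<subseteq> S \<and> (\<forall>u\<in>A. \<forall>v\<in>A. (u, v) \<notin> E) \<and>
     (\<forall>a\<in>A. \<forall>u v. (a, u) \<in> E \<and> (a, v) \<in> E \<and> u \<in> S - A \<and>
        (u, v) \<in> (E \<inter> (S - A) \<times> (S - A))\<^sup>* \<longrightarrow> u = v)"

text \<open>A path that avoids the preimage of \<open>A\<close> is mapped by \<open>f\<close> to a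
  path that avoids \<open>A\<close>. Hence two neighbours of one vertex in the same component have
  equal images, and injectivity identifies them. This pulls splitting sets back from
  \<open>zykov k\<close> to \<open>G\<close>.\<close>

lemma splitting_vimage:
  assumes inj: "inj_on f S"
    and edges: "\<And>u v. u \<in> S \<Longrightarrow> v \<in> S \<Longrightarrow> (u, v) \<in> E \<longleftrightarrow> (f u, f v) \<in> F"
    and split: "splitting F (f ` S) A"
  shows "splitting E S {x \<in> S. f x \<in> A}"
  unfolding splitting_def
proof (intro conjI ballI allI impI, goal_cases)
  case (3 a u v)
  let ?B = "{x \<in> S. f x \<in> A}"
  from 3 have u: "u \<in> S" "f u \<notin> A" and path: "(u, v) \<in> (E \<inter> (S - ?B) \<times> (S - ?B))\<^sup>*"
    by auto
  from path have "v \<in> S \<and> (f u, f v) \<in> (F \<inter> (f ` S - A) \<times> (f ` S - A))\<^sup>*"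
  proof induction
    case (step y z)
    then have "(f y, f z) \<in> F \<inter> (f ` S - A) \<times> (f ` S - A)"
      using edges by auto
    with step show ?case by (auto intro: rtrancl_into_rtrancl)
  qed (simp add: u)
  then have "f u = f v" "v \<in> S"
    using split 3 u edges unfolding splitting_def by (auto; blast)+
  with inj u show ?case by (auto dest: inj_onD)
qed (use split edges in \<open>auto simp: splitting_def\<close>)

text \<open>Deleting \<open>A\<close> leaves a symmetric digraph, where every path can be reversed;
  so lying in a common strongly connected component amounts to plain reachability.\<close>

lemma splitting_stable_set_iff_splitting:
  assumes "sym_digraph H"
  shows "splitting_stable_set H A \<longleftrightarrow> splitting (arcs_ends H) (verts H) A"
proof -
  interpret H: sym_digraph H by fact
  let ?HA = "H \<restriction> (verts H - A)"
  interpret HA: wf_digraph ?HA by (rule H.wellformed_induce_subgraph)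
  have ends: "arcs_ends ?HA = arcs_ends H \<inter> (verts H - A) \<times> (verts H - A)"
    by (auto simp: arcs_ends_conv)
  have "symmetric ?HA"
    using H.sym_arcs unfolding symmetric_def ends by (auto simp: sym_def)
  then interpret HA: sym_digraph ?HA by unfold_locales
  have comp: "(\<exists>C\<in>HA.sccs. u \<in> verts C \<and> v \<in> verts C) \<longleftrightarrow>
      u \<in> verts H - A \<and> (u, v) \<in> (arcs_ends H \<inter> (verts H - A) \<times> (verts H - A))\<^sup>*" (is "?L \<longleftrightarrow> ?R")
    for u v
  proof
    assume ?L
    then obtain C where "C \<in> HA.sccs" "u \<in> verts C" "v \<in> verts C" by blast
    then have "u \<rightarrow>\<^sup>*\<^bsub>?HA\<^esub> v"
      using HA.in_sccs_vertsI_sccs[of "verts C"] by (auto simp: HA.in_sccs_verts_conv_reachable)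
    then show ?R
      using HA.reachable_in_verts HA.reachable_conv ends by auto
  next
    assume ?R
    then have r: "u \<rightarrow>\<^sup>*\<^bsub>?HA\<^esub> v"
      using HA.reachable_conv' ends by simp
    then have "v \<in> HA.scc_of u" "u \<in> HA.scc_of u"
      using \<open>?R\<close> HA.symmetric_reachable'[OF r] by (auto simp: HA.scc_of_def)
    moreover have "HA.scc_of u \<in> HA.sccs_verts"
      using \<open>?R\<close> by (intro HA.scc_of_in_sccs_verts) simp
    ultimately show ?L
      unfolding HA.sccs_verts_conv by blast
  qed
  have "(\<forall>C\<in>HA.sccs. \<forall>u\<in>verts C. \<forall>v\<in>verts C.
        (a, u) \<in> arcs_ends H \<and> (a, v) \<in> arcs_ends H \<longrightarrow> u = v) \<longleftrightarrow>
      (\<forall>u v. (a, u) \<in> arcs_ends H \<and> (a, v) \<in> arcs_ends H \<and> u \<in> verts H - A \<and>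
        (u, v) \<in> (arcs_ends H \<inter> (verts H - A) \<times> (verts H - A))\<^sup>* \<longrightarrow> u = v)" for a
    unfolding comp[symmetric] by blast
  then show ?thesis
    by (simp only: splitting_stable_set_def splitting_def stable_set_def conj_assoc)
qed

section \<open>Adjacency in Zykov's graphs\<close>

lemma zykov_Suc: "1 \<le> p \<Longrightarrow> zykov (Suc p) = zykov_step p zykov"
  by (cases p) simp_all

lemma parcs_zykov_step:
  "(Copy i u, Copy j v) \<in> parcs (zykov_step k Z) \<longleftrightarrow> i = j \<and> i \<in> {1..k} \<and> (u, v) \<in> parcs (Z i)"
  "(Apex vs, Copy i v) \<in> parcs (zykov_step k Z) \<longleftrightarrow>
     vs \<in> zykov_tuples k Z \<and> i \<in> {1..k} \<and> v = vs ! (i - 1)"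
  "(Copy i v, Apex vs) \<in> parcs (zykov_step k Z) \<longleftrightarrow>
     vs \<in> zykov_tuples k Z \<and> i \<in> {1..k} \<and> v = vs ! (i - 1)"
  "(Apex vs, Apex ws) \<notin> parcs (zykov_step k Z)"
  by (auto simp: zykov_step_def)

text \<open>Apices of all earlier graphs form a tuple, and the vertex added for it is an apex of the
  next graph. These apices later serve as default coordinates.\<close>

lemma Apex_in_zykov: "1 \<le> k \<Longrightarrow> \<exists>vs. Apex vs \<in> pverts (zykov k)"
proof (induction k rule: less_induct)
  case (less k)
  show ?case
  proof (cases "k = 1")
    case False
    with less.prems obtain p where p: "k = Suc p" "1 \<le> p"
      by (cases k) auto
    from less.IH p have "\<forall>i\<in>{1..p}. \<exists>vs. Apex vs \<in> pverts (zykov i)" by simp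
    then obtain w where "\<forall>i\<in>{1..p}. Apex (w i) \<in> pverts (zykov i)" by metis
    then have "map (\<lambda>i. Apex (w i)) [1..<Suc p] \<in> zykov_tuples p zykov"
      by (auto simp: zykov_tuples_def simp del: upt_Suc)
    with p show ?thesis by (auto simp: zykov_Suc Apex_in_zykov_step)
  qed simp
qed

section \<open>Induced subgraphs of Zykov's graphs have splitting sets\<close>

text \<open>Distinct copies are joined only through apices, so a path without apices stays in the
  copy where it starts and projects to a path of \<open>Z i\<close>.\<close>

lemma zykov_step_path_in_Copy:
  assumes "(Copy i u, y) \<in> (parcs (zykov_step k Z) \<inter> T \<times> T)\<^sup>*" and "T \<inter> range Apex = {}"
  shows "\<exists>v. y = Copy i v \<and> (u, v) \<in> (parcs (Z i) \<inter> {w. Copy i w \<in> T} \<times> {w. Copy i w \<in> T})\<^sup>*"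
  using assms(1)
proof induction
  case (step y z)
  then obtain v where v: "y = Copy i v"
    "(u, v) \<in> (parcs (Z i) \<inter> {w. Copy i w \<in> T} \<times> {w. Copy i w \<in> T})\<^sup>*" by blast
  from step.hyps(2) assms(2) obtain j w where "z = Copy j w" by (cases z) auto
  with step.hyps(2) v(1) have "z = Copy i w"
    "(v, w) \<in> parcs (Z i) \<inter> {w. Copy i w \<in> T} \<times> {w. Copy i w \<in> T}"
    by (auto simp: parcs_zykov_step)
  with v(2) show ?case by (auto intro: rtrancl_into_rtrancl)
qed simp

lemma ex_splitting_zykov:
  assumes "S \<subseteq> pverts (zykov k)" and "S \<noteq> {}"
  shows "\<exists>A. A \<noteq> {} \<and> splitting (parcs (zykov k)) S A"
  using assms
proof (induction k arbitrary: S rule: less_induct)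
  case (less k)
  from less.prems have "k \<noteq> 0" by (cases k) auto
  then consider "k = 1" | p where "k = Suc p" "1 \<le> p"
    by (cases k; cases "k - 1") auto
  then show ?case
  proof cases
    case 1
    with less.prems show ?thesis by (auto simp: splitting_def intro!: exI[of _ S])
  next
    case (2 p)
    let ?Z = "zykov_step p zykov"
    have Z: "zykov k = ?Z" using 2 zykov_Suc by simp
    show ?thesis
    proof (cases "S \<inter> range Apex = {}")
      case False
      \<comment> \<open>Without the apices, each component lies inside a single copy, and there the
        apex of a tuple has only one neighbour, the coordinate for that copy.\<close>
      let ?A = "S \<inter> range Apex"
      have "splitting (parcs ?Z) S ?A"
        unfolding splitting_def
      proof (intro conjI ballI allI impI, goal_cases)
        case (3 a u v)
        then obtain vs i w where a: "a = Apex vs" and u: "u = Copy i w"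
          by (cases u) auto
        from 3 u obtain w' where "v = Copy i w'"
          using zykov_step_path_in_Copy[of i w v p zykov "S - ?A"] by auto
        with 3 a u show ?case by (auto simp: parcs_zykov_step)
      qed (auto simp: parcs_zykov_step)
      with False Z show ?thesis by (intro exI[of _ ?A]) simp
    next
      case True
      from \<open>S \<noteq> {}\<close> obtain x where "x \<in> S" by blast
      with True obtain i w where w: "Copy i w \<in> S" by (cases x) auto
      let ?S = "{w. Copy i w \<in> S}"
      from w less.prems(1) have i: "i \<in> {1..p}" and sub: "?S \<subseteq> pverts (zykov i)"
        by (auto simp: Z Copy_in_zykov_step)
      have "i < k" using i 2 by simp
      from less.IH[OF this sub] w obtain A
        where A: "A \<noteq> {}" "splitting (parcs (zykov i)) ?S A" by blast
      \<comment> \<open>With no apex in \<open>S\<close>, all neighbours in \<open>S\<close> of a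
        vertex of copy \<open>i\<close> lie in copy \<open>i\<close>, and components met there
        project into copy \<open>i\<close>. The other copies impose no condition.\<close>
      have "splitting (parcs ?Z) S (Copy i ` A)"
        unfolding splitting_def
      proof (intro conjI ballI allI impI, goal_cases)
        case (3 a u v)
        then obtain a' where a: "a = Copy i a'" "a' \<in> A" by auto
        from 3 True obtain j u' where "u = Copy j u'" by (cases u) auto
        with 3 a have u: "u = Copy i u'" "u' \<in> ?S - A" "(a', u') \<in> parcs (zykov i)"
          by (auto simp: parcs_zykov_step)
        have T: "{w. Copy i w \<in> S - Copy i ` A} = ?S - A" by auto
        from 3 u(1) True obtain v' where v: "v = Copy i v'"
            "(u', v') \<in> (parcs (zykov i) \<inter> (?S - A) \<times> (?S - A))\<^sup>*"
          using zykov_step_path_in_Copy[of i u' v p zykov "S - Copy i ` A"] unfolding T by auto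
        with 3 a have "(a', v') \<in> parcs (zykov i)" by (auto simp: parcs_zykov_step)
        with A(2) a u v have "u' = v'" unfolding splitting_def by blast
        with u v show ?case by simp
      qed (use A in \<open>auto simp: parcs_zykov_step splitting_def\<close>)
      with A(1) Z show ?thesis by (intro exI[of _ "Copy i ` A"]) simp
    qed
  qed
qed

section \<open>Embedding graphs with splitting sets into Zykov's graphs\<close>

text \<open>An isomorphism onto an induced subgraph, recorded by its vertex map only: edges are both
  preserved and reflected. An empty \<open>S\<close> is allowed, as the induction below meets
  it.\<close>

definition zykov_embedding :: "'a rel \<Rightarrow> 'a set \<Rightarrow> nat \<Rightarrow> ('a \<Rightarrow> zvertex) \<Rightarrow> bool" where
  "zykov_embedding E S k f \<longleftrightarrow> inj_on f S \<and> f ` S \<subseteq> pverts (zykov k) \<and>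
     (\<forall>u\<in>S. \<forall>v\<in>S. (u, v) \<in> E \<longleftrightarrow> (f u, f v) \<in> parcs (zykov k))"

text \<open>Symmetry makes reachability an equivalence relation, and its finitely many classes
  meeting \<open>T\<close> are numbered by an injection. The numbers decide which Zykov graph
  receives which component.\<close>

lemma ex_component_index:
  assumes "finite T" and "sym R"
  shows "\<exists>(c :: 'a \<Rightarrow> nat) n. (\<forall>x\<in>T. c x < n) \<and> (\<forall>x\<in>T. \<forall>y\<in>T. c x = c y \<longleftrightarrow> (x, y) \<in> R\<^sup>*)"
proof -
  have eqv: "equiv UNIV (R\<^sup>*)"
    using assms(2) by (auto intro!: equivI refl_rtrancl sym_rtrancl trans_rtrancl)
  let ?cls = "\<lambda>x. R\<^sup>* `` {x}"
  obtain h :: "'a set \<Rightarrow> nat" and n where h: "h ` ?cls ` T = {i. i < n}" "inj_on h (?cls ` T)"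
    using finite_imp_inj_to_nat_seg[of "?cls ` T"] assms(1) by blast
  have "h (?cls x) < n" if "x \<in> T" for x using h(1) that by blast
  moreover have "h (?cls x) = h (?cls y) \<longleftrightarrow> (x, y) \<in> R\<^sup>*" if "x \<in> T" "y \<in> T" for x y
    using that h(2) eq_equiv_class_iff[OF eqv, of x y] by (auto simp: inj_on_eq_iff)
  ultimately show ?thesis by (intro exI[of _ "h \<circ> ?cls"] exI[of _ n]) auto
qed

text \<open>
  Component \<open>j\<close> of \<open>S - A\<close> goes into \<open>Z\<^sub>K\<^sub>+\<^sub>1\<^sub>+\<^sub>j\<close> by way of its subgraph \<open>Z\<^bsub>k j\<^esub>\<close>; the apices of
  \<open>Z\<^sub>K\<^sub>+\<^sub>1\<^sub>+\<^sub>j\<close> are thus left free to serve as coordinates of the vertices of \<open>A\<close> that have no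
  neighbour in component \<open>j\<close>. The last coordinate \<open>p\<close> tells the vertices of \<open>A\<close> apart.
\<close>
lemma zykov_embedding_of_components:
  fixes c :: "'a \<Rightarrow> nat"
  assumes "finite S" and "sym E" and split: "splitting E S A"
    and c: "\<And>x. x \<in> S - A \<Longrightarrow> c x < n"
      "\<And>x y. x \<in> S - A \<Longrightarrow> y \<in> S - A \<Longrightarrow> c x = c y \<longleftrightarrow> (x, y) \<in> (E \<inter> (S - A) \<times> (S - A))\<^sup>*"
    and k: "\<And>j. j < n \<Longrightarrow> 1 \<le> k j"
    and f: "\<And>j. j < n \<Longrightarrow> zykov_embedding E {x \<in> S - A. c x = j} (k j) (f j)"
  shows "\<exists>k\<ge>1. \<exists>g. zykov_embedding E S k g"
proof -
  \<comment> \<open>A common bound \<open>K\<close> on the \<open>k j\<close> makes the indices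
    \<open>Suc (K + j)\<close> distinct and each larger than its \<open>k j\<close>.\<close>
  have "finite (k ` {..<n})" by simp
  then obtain K where "\<forall>i\<in>k ` {..<n}. i \<le> K"
    unfolding finite_nat_set_iff_bounded_le by blast
  then have K: "k j \<le> K" if "j < n" for j using that by simp
  have "finite A"
    using split \<open>finite S\<close> by (auto simp: splitting_def intro: finite_subset)
  then obtain h :: "'a \<Rightarrow> nat" and m where h: "h ` A = {i. i < m}" "inj_on h A"
    using finite_imp_inj_to_nat_seg[of A] by blast
  \<comment> \<open>Large enough for two purposes: every index \<open>Suc (K + j)\<close> with
    \<open>j < n\<close> stays below \<open>p\<close>, and so does every \<open>Suc (h a)\<close>,
    so that the last coordinate of \<open>a\<close> can lie in copy \<open>Suc (h a)\<close> inside
    \<open>zykov p\<close>. The \<open>Suc\<close> is there because copies are numbered from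
    1.\<close>
  define p where "p = Suc (K + n + m)"
  obtain w where w: "\<And>i. 1 \<le> i \<Longrightarrow> Apex (w i) \<in> pverts (zykov i)"
    using Apex_in_zykov by metis
  define idx where "idx x = Suc (K + c x)" for x
  \<comment> \<open>This \<open>Copy\<close> puts \<open>zykov (k (c x))\<close> inside
    \<open>zykov (idx x)\<close>; \<open>g\<close> wraps a second one around it. Being a
    \<open>Copy\<close>, \<open>e x\<close> never equals a default coordinate
    \<open>Apex (w i)\<close>.\<close>
  define e where "e x = Copy (k (c x)) (f (c x) x)" for x
  define t where "t a i =
      (if i = p then Copy (Suc (h a)) (Apex (w (Suc (h a))))
       else if \<exists>u\<in>S - A. (a, u) \<in> E \<and> idx u = i then e (SOME u. u \<in> S - A \<and> (a, u) \<in> E \<and> idx u = i)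
       else Apex (w i))" for a i
  define g where "g x = (if x \<in> A then Apex (map (t x) [1..<Suc p]) else Copy (idx x) (e x))" for x
  have Z: "zykov (Suc p) = zykov_step p zykov"
    by (rule zykov_Suc) (simp add: p_def)

  \<comment> \<open>Images of the components\<close>
  have fc: "zykov_embedding E {y \<in> S - A. c y = c x} (k (c x)) (f (c x))"
    and kc: "1 \<le> k (c x)" "k (c x) \<le> K" if "x \<in> S - A" for x
    using f k K c(1) that by auto
  have idx: "1 \<le> idx x" "idx x < p" "k (c x) < idx x" if "x \<in> S - A" for x
    using c(1)[OF that] kc[OF that] by (auto simp: idx_def p_def)
  have Z_idx: "zykov (idx x) = zykov_step (K + c x) zykov" if "x \<in> S - A" for x
    unfolding idx_def using kc[OF that] by (intro zykov_Suc) simp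
  have e_in: "e x \<in> pverts (zykov (idx x))" if "x \<in> S - A" for x
    using fc[OF that] kc[OF that] that
    by (auto simp: e_def Z_idx Copy_in_zykov_step zykov_embedding_def)
  have e_eq: "x = y" if "x \<in> S - A" "y \<in> S - A" "idx x = idx y" "e x = e y" for x y
    using that fc[OF that(1)] by (auto simp: e_def idx_def zykov_embedding_def inj_on_def)
  have e_edge: "(x, y) \<in> E \<longleftrightarrow> (e x, e y) \<in> parcs (zykov (idx x))"
    if "x \<in> S - A" "y \<in> S - A" "idx x = idx y" for x y
  proof -
    have c: "c y = c x" using that(3) by (simp add: idx_def)
    have "(e x, e y) \<in> parcs (zykov (idx x)) \<longleftrightarrow>
        (f (c x) x, f (c x) y) \<in> parcs (zykov (k (c x)))"
      unfolding Z_idx[OF that(1)] e_def c using kc[OF that(1)] by (simp add: parcs_zykov_step)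
    with fc[OF that(1)] that c show ?thesis by (simp add: zykov_embedding_def)
  qed
  have idx_eq: "idx x = idx y" if "x \<in> S - A" "y \<in> S - A" "(x, y) \<in> E" for x y
    using that c(2)[of x y] by (auto simp: idx_def)

  \<comment> \<open>Coordinates of the tuples assigned to \<open>A\<close>\<close>
  have t_idx: "t a (idx x) = e x" if "x \<in> S - A" "a \<in> A" "(a, x) \<in> E" for a x
  proof -
    \<comment> \<open>Neighbours of \<open>a\<close> with equal index lie in one component, so the
      splitting property leaves only one candidate for the choice in \<open>t\<close>.\<close>
    have "u = x" if "u \<in> S - A" "(a, u) \<in> E" "idx u = idx x" for u
    proof -
      have "(u, x) \<in> (E \<inter> (S - A) \<times> (S - A))\<^sup>*"
        using c(2)[of u x] that \<open>x \<in> S - A\<close> by (simp add: idx_def)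
      then show ?thesis
        using split that \<open>a \<in> A\<close> \<open>(a, x) \<in> E\<close> unfolding splitting_def by blast
    qed
    then have "(SOME u. u \<in> S - A \<and> (a, u) \<in> E \<and> idx u = idx x) = x"
      using that by (intro some_equality) auto
    then show ?thesis using that idx[OF that(1)] by (auto simp: t_def)
  qed
  have t_edge: "(a, x) \<in> E \<longleftrightarrow> t a (idx x) = e x" if a: "a \<in> A" and x: "x \<in> S - A" for a x
  proof
    \<comment> \<open>A coordinate of the form \<open>e x\<close> at an index below \<open>p\<close>
      is not the default, so it comes from some neighbour \<open>u\<close> of \<open>a\<close> with
      the same index; then \<open>e u = e x\<close> yields \<open>u = x\<close>.\<close>
    assume eq: "t a (idx x) = e x"
    then obtain u where u: "u \<in> S - A" "(a, u) \<in> E" "idx u = idx x"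
      using idx[OF x] by (auto simp: t_def e_def split: if_splits)
    with t_idx[of u a] a x eq e_eq[of u x] show "(a, x) \<in> E" by auto
  qed (use t_idx a x in simp)
  have t_in: "t a i \<in> pverts (zykov i)" if "a \<in> A" "i \<in> {1..p}" for a i
  proof -
    consider "i = p" | u where "i \<noteq> p" "u \<in> S - A" "(a, u) \<in> E" "i = idx u"
      | "i \<noteq> p" "\<not> (\<exists>u\<in>S - A. (a, u) \<in> E \<and> idx u = i)" by blast
    then show ?thesis
    proof cases
      case 1
      have "h a < m" using h(1) that(1) by blast
      then have "Suc (h a) \<in> {1..K + n + m}" by simp
      moreover have "zykov p = zykov_step (K + n + m) zykov"
        unfolding p_def using \<open>h a < m\<close> by (intro zykov_Suc) simp
      ultimately show ?thesis
        using 1 w by (simp add: t_def Copy_in_zykov_step)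
    next
      case 2
      with t_idx that(1) e_in show ?thesis by simp
    next
      case 3
      then have "t a i = Apex (w i)" unfolding t_def by (simp only: if_False)
      with w that(2) show ?thesis by simp
    qed
  qed
  have tup: "map (t a) [1..<Suc p] \<in> zykov_tuples p zykov" if "a \<in> A" for a
    using t_in[OF that] by (auto simp: zykov_tuples_def simp del: upt_Suc)
  have nth: "map (t a) [1..<Suc p] ! (i - 1) = t a i" if "i \<in> {1..p}" for a i
    using that by (auto simp del: upt_Suc)

  \<comment> \<open>The combined map is an induced embedding\<close>
  have "inj_on g S"
  proof (rule inj_onI)
    fix x y assume xy: "x \<in> S" "y \<in> S" "g x = g y"
    show "x = y"
    proof (cases "x \<in> A")
      case True
      with xy have "y \<in> A" and "\<forall>i\<in>{1..<Suc p}. t x i = t y i"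
        by (auto simp: g_def simp del: upt_Suc split: if_splits)
      then have "t x p = t y p" by (simp add: p_def)
      with h(2) True \<open>y \<in> A\<close> show ?thesis by (simp add: t_def inj_on_eq_iff)
    next
      case False
      with xy e_eq[of x y] show ?thesis by (auto simp: g_def split: if_splits)
    qed
  qed
  moreover have "g ` S \<subseteq> pverts (zykov (Suc p))"
    using tup idx e_in
    by (auto simp: g_def Z Copy_in_zykov_step Apex_in_zykov_step less_imp_le simp del: upt_Suc)
  moreover have "(x, y) \<in> E \<longleftrightarrow> (g x, g y) \<in> parcs (zykov (Suc p))" if "x \<in> S" "y \<in> S" for x y
  proof -
    have AB: "(a, b) \<in> E \<longleftrightarrow> (g a, g b) \<in> parcs (zykov (Suc p))"
        "(b, a) \<in> E \<longleftrightarrow> (g b, g a) \<in> parcs (zykov (Suc p))" if "a \<in> A" "b \<in> S - A" for a b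
    proof -
      have "idx b \<in> {1..p}" using idx[OF that(2)] by simp
      then have "(g a, g b) \<in> parcs (zykov (Suc p)) \<longleftrightarrow> t a (idx b) = e b"
          "(g b, g a) \<in> parcs (zykov (Suc p)) \<longleftrightarrow> t a (idx b) = e b"
        using that nth[of "idx b" a] tup[OF that(1)]
        by (auto simp: g_def Z parcs_zykov_step simp del: upt_Suc)
      with t_edge[OF that] \<open>sym E\<close> show "(a, b) \<in> E \<longleftrightarrow> (g a, g b) \<in> parcs (zykov (Suc p))"
        "(b, a) \<in> E \<longleftrightarrow> (g b, g a) \<in> parcs (zykov (Suc p))"
        by (auto dest: symD)
    qed
    consider "x \<in> A" "y \<in> A" | "x \<in> A" "y \<in> S - A" | "x \<in> S - A" "y \<in> A"
      | "x \<in> S - A" "y \<in> S - A" using \<open>x \<in> S\<close> \<open>y \<in> S\<close> by blast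
    then show ?thesis
    proof cases
      case 1
      with split show ?thesis
        by (auto simp: g_def Z parcs_zykov_step splitting_def simp del: upt_Suc)
    next
      case 4
      \<comment> \<open>Vertices in different copies are nonadjacent; on the side of
        \<open>E\<close> this matches the fact that adjacent vertices of \<open>S - A\<close> share
        their component and hence their index.\<close>
      then have "(g x, g y) \<in> parcs (zykov (Suc p)) \<longleftrightarrow>
          idx x = idx y \<and> (e x, e y) \<in> parcs (zykov (idx x))"
        using idx[of x] by (auto simp: g_def Z parcs_zykov_step)
      with e_edge[of x y] idx_eq[of x y] 4 show ?thesis by blast
    qed (use AB in blast)+
  qed
  ultimately have "zykov_embedding E S (Suc p) g"
    by (simp add: zykov_embedding_def)
  then show ?thesis by (intro exI[of _ "Suc p"]) auto
qed

text \<open>Induction over proper subsets: since \<open>A\<close> is non-empty, each component of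
  \<open>S - A\<close> is smaller than \<open>S\<close>, and the hypothesis on subsets passes down
  to it. Numbers \<open>j\<close> that belong to no vertex give the empty set, which embeds
  trivially.\<close>

lemma ex_zykov_embedding:
  assumes "finite S" and "sym E"
    and "\<And>T. T \<subseteq> S \<Longrightarrow> T \<noteq> {} \<Longrightarrow> \<exists>A. A \<noteq> {} \<and> splitting E T A"
  shows "\<exists>k\<ge>1. \<exists>f. zykov_embedding E S k f"
  using assms(1,3)
proof (induction S rule: finite_psubset_induct)
  case (psubset S)
  show ?case
  proof (cases "S = {}")
    case True
    then show ?thesis by (auto simp: zykov_embedding_def)
  next
    case False
    then obtain A where A: "A \<noteq> {}" "splitting E S A"
      using psubset.prems by blast
    let ?R = "E \<inter> (S - A) \<times> (S - A)"
    have "sym ?R" using \<open>sym E\<close> by (auto simp: sym_def)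
    then obtain c :: "'a \<Rightarrow> nat" and n where c: "\<forall>x\<in>S - A. c x < n"
        "\<forall>x\<in>S - A. \<forall>y\<in>S - A. c x = c y \<longleftrightarrow> (x, y) \<in> ?R\<^sup>*"
      using ex_component_index[of "S - A" ?R] psubset.hyps by blast
    have "\<exists>k\<ge>1. \<exists>f. zykov_embedding E {x \<in> S - A. c x = j} k f" for j
    proof (rule psubset.IH)
      show "{x \<in> S - A. c x = j} \<subset> S"
        using A unfolding splitting_def by blast
    qed (use psubset.prems in blast)
    then obtain k f where "\<And>j. 1 \<le> k j" "\<And>j. zykov_embedding E {x \<in> S - A. c x = j} (k j) (f j)"
      by metis
    with zykov_embedding_of_components[OF psubset.hyps(1) \<open>sym E\<close> A(2), of c n k f] c
    show ?thesis by blast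
  qed
qed

section \<open>From vertex maps back to digraph isomorphisms\<close>

lemma is_zykov_graph_iff_embedding:
  assumes "nomulti_digraph G" and "verts G \<noteq> {}"
  shows "is_zykov_graph G \<longleftrightarrow> (\<exists>k\<ge>1. \<exists>f. zykov_embedding (arcs_ends G) (verts G) k f)"
proof
  interpret nomulti_digraph G by fact
  assume "is_zykov_graph G"
  then obtain k H iso where k: "k \<ge> 1" and H: "induced_subgraph H (with_proj (zykov k))"
    and iso: "digraph_isomorphism iso" "H = app_iso iso G"
    unfolding is_zykov_graph_def digraph_iso_def by blast
  let ?f = "iso_verts iso"
  have inj: "inj_on ?f (verts G)"
    using iso(1) by (rule digraph_isomorphism_inj_on_verts)
  have H': "verts H \<subseteq> pverts (zykov k)" "tail H = fst" "head H = snd"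
      "arcs H = {e \<in> parcs (zykov k). fst e \<in> verts H \<and> snd e \<in> verts H}"
    using H by (auto simp: induced_subgraph_def subgraph_def compatible_def)
  have ends: "arcs_ends H = arcs H" using H'(2,3) by (simp add: arcs_ends_conv)
  have "(u, v) \<in> arcs_ends G \<longleftrightarrow> (?f u, ?f v) \<in> parcs (zykov k)"
    if "u \<in> verts G" "v \<in> verts G" for u v
  proof -
    have "(u, v) \<in> arcs_ends G \<longleftrightarrow> (?f u, ?f v) \<in> arcs_ends H"
      unfolding iso(2) arcs_ends_app_iso_eq[OF iso(1)]
      using that inj adj_in_verts by (auto simp: inj_on_eq_iff image_iff Bex_def split_beta)
    also have "\<dots> \<longleftrightarrow> (?f u, ?f v) \<in> parcs (zykov k)"
      unfolding ends H'(4) using that by (simp add: iso(2))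
    finally show ?thesis .
  qed
  with inj H'(1) iso(2) have "zykov_embedding (arcs_ends G) (verts G) k ?f"
    by (simp add: zykov_embedding_def)
  with k show "\<exists>k\<ge>1. \<exists>f. zykov_embedding (arcs_ends G) (verts G) k f" by blast
next
  interpret nomulti_digraph G by fact
  assume "\<exists>k\<ge>1. \<exists>f. zykov_embedding (arcs_ends G) (verts G) k f"
  then obtain k f where k: "k \<ge> 1" and f: "inj_on f (verts G)" "f ` verts G \<subseteq> pverts (zykov k)"
    and edges: "\<And>u v. u \<in> verts G \<Longrightarrow> v \<in> verts G \<Longrightarrow>
      (u, v) \<in> arcs_ends G \<longleftrightarrow> (f u, f v) \<in> parcs (zykov k)"
    by (auto simp: zykov_embedding_def)
  \<comment> \<open>The vertex map determines the arc map: an arc goes to the pair of images of its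
    ends. This is injective because \<open>f\<close> is and \<open>G\<close> has no parallel
    arcs.\<close>
  define iso where "iso = \<lparr>iso_verts = f, iso_arcs = \<lambda>a. (f (tail G a), f (head G a)),
    iso_head = snd, iso_tail = fst\<rparr>"
  have iso: "digraph_isomorphism iso"
    using f(1) no_multi_arcs
    by (auto simp: digraph_isomorphism_def iso_def wf_digraph inj_on_eq_iff arc_to_ends_def
        intro!: inj_onI)
  interpret Z: pair_graph "zykov k" by (rule pair_graph_zykov)
  have "induced_subgraph (app_iso iso G) (with_proj (zykov k))"
    unfolding induced_subgraph_def subgraph_def
  proof (intro conjI)
    have arcs: "arcs (app_iso iso G) = (\<lambda>(u, v). (f u, f v)) ` arcs_ends G"
      by (auto simp: iso_def arcs_ends_conv image_image)
    also have "\<dots> = {e \<in> parcs (zykov k). fst e \<in> f ` verts G \<and> snd e \<in> f ` verts G}"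
    proof (intro equalityI subsetI)
      fix e assume "e \<in> {e \<in> parcs (zykov k). fst e \<in> f ` verts G \<and> snd e \<in> f ` verts G}"
      then obtain u v where "u \<in> verts G" "v \<in> verts G" "e = (f u, f v)" "e \<in> parcs (zykov k)"
        by (cases e) auto
      then show "e \<in> (\<lambda>(u, v). (f u, f v)) ` arcs_ends G"
        using edges by (intro image_eqI[of _ _ "(u, v)"]) auto
    next
      fix e assume "e \<in> (\<lambda>(u, v). (f u, f v)) ` arcs_ends G"
      then obtain u v where "(u, v) \<in> arcs_ends G" "e = (f u, f v)" by auto
      moreover from this(1) have "u \<in> verts G" "v \<in> verts G" by (auto dest: adj_in_verts)
      ultimately show "e \<in> {e \<in> parcs (zykov k). fst e \<in> f ` verts G \<and> snd e \<in> f ` verts G}"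
        using edges by simp
    qed
    finally have arcs: "arcs (app_iso iso G) =
      {e \<in> parcs (zykov k). fst e \<in> f ` verts G \<and> snd e \<in> f ` verts G}" .
    then show "arcs (app_iso iso G) \<subseteq> arcs (with_proj (zykov k))"
      "arcs (app_iso iso G) = {e \<in> arcs (with_proj (zykov k)).
        tail (with_proj (zykov k)) e \<in> verts (app_iso iso G) \<and>
        head (with_proj (zykov k)) e \<in> verts (app_iso iso G)}"
      by (auto simp: iso_def)
  qed (use f(2) iso in \<open>auto simp: iso_def compatible_def Z.wf_digraph intro: wf_digraphI_app_iso\<close>)
  with k iso assms(2) show "is_zykov_graph G"
    unfolding is_zykov_graph_def digraph_iso_def
    by (intro exI[of _ k] conjI exI[of _ "app_iso iso G"]) auto
qed

theorem theorem1:
  fixes G :: "('a, 'b) pre_digraph"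
  assumes "graph G" and "verts G \<noteq> {}"
  shows "is_zykov_graph G \<longleftrightarrow>
    (\<forall>H. induced_subgraph H G \<and> verts H \<noteq> {} \<longrightarrow>
      (\<exists>A. A \<noteq> {} \<and> splitting_stable_set H A))"
proof -
  interpret graph G by fact
  have symE: "sym (arcs_ends G)" using sym_arcs by (simp add: symmetric_def)
  have ends: "arcs_ends H = arcs_ends G \<inter> verts H \<times> verts H" and sub: "verts H \<subseteq> verts G"
    and sd: "sym_digraph H" if "induced_subgraph H G" for H
  proof -
    show "arcs_ends H = arcs_ends G \<inter> verts H \<times> verts H" "verts H \<subseteq> verts G"
      using that by (auto simp: induced_subgraph_def subgraph_def compatible_def arcs_ends_conv)
    show "sym_digraph H" using that by (rule induced_graph_imp_graph)
  qed
  \<comment> \<open>\<open>splitting\<close> only looks at pairs inside \<open>T\<close>, so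
    restricting the relation to \<open>T\<close> changes nothing; formally this is the pullback
    along the identity.\<close>
  have restr: "splitting (E \<inter> T \<times> T) T A \<longleftrightarrow> splitting E T A" for E :: "'a rel" and T A
  proof -
    have *: "splitting F T A \<Longrightarrow> splitting F' T A"
      if "\<And>u v. u \<in> T \<Longrightarrow> v \<in> T \<Longrightarrow> (u, v) \<in> F' \<longleftrightarrow> (u, v) \<in> F" for F F' :: "'a rel"
    proof -
      assume F: "splitting F T A"
      then have "{x \<in> T. x \<in> A} = A" by (auto simp: splitting_def)
      with splitting_vimage[of "\<lambda>x. x" T F' F A] that F show ?thesis by simp
    qed
    show ?thesis
      using *[of "E \<inter> T \<times> T" E] *[of E "E \<inter> T \<times> T"] by (intro iffI) auto
  qed
  have split: "splitting_stable_set H A \<longleftrightarrow> splitting (arcs_ends G) (verts H) A"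
    if "induced_subgraph H G" for H A
    using splitting_stable_set_iff_splitting[OF sd[OF that]] ends[OF that] restr by simp
  \<comment> \<open>Induced subgraphs are replaced by their vertex sets \<open>T\<close>, which
    keeps the core equivalence free of digraphs other than \<open>G\<close>.\<close>
  have "(\<exists>k\<ge>1. \<exists>f. zykov_embedding (arcs_ends G) (verts G) k f) \<longleftrightarrow>
    (\<forall>T. T \<subseteq> verts G \<and> T \<noteq> {} \<longrightarrow> (\<exists>A. A \<noteq> {} \<and> splitting (arcs_ends G) T A))"
    (is "?L \<longleftrightarrow> ?R")
  proof (intro iffI allI impI)
    fix T assume "?L" and T: "T \<subseteq> verts G \<and> T \<noteq> {}"
    then obtain k f where f: "zykov_embedding (arcs_ends G) (verts G) k f" by blast
    then obtain A where A: "A \<noteq> {}" "splitting (parcs (zykov k)) (f ` T) A"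
      using ex_splitting_zykov[of "f ` T" k] T by (auto simp: zykov_embedding_def)
    have "splitting (arcs_ends G) T {x \<in> T. f x \<in> A}"
      using f T A(2)
      by (intro splitting_vimage) (auto simp: zykov_embedding_def intro: inj_on_subset)
    moreover have "{x \<in> T. f x \<in> A} \<noteq> {}" using A by (auto simp: splitting_def)
    ultimately show "\<exists>A. A \<noteq> {} \<and> splitting (arcs_ends G) T A" by (intro exI conjI)
  next
    assume ?R
    then show ?L by (intro ex_zykov_embedding finite_verts symE) simp
  qed
  also have "\<dots> \<longleftrightarrow> (\<forall>H. induced_subgraph H G \<and> verts H \<noteq> {} \<longrightarrow>
      (\<exists>A. A \<noteq> {} \<and> splitting_stable_set H A))"
  proof (intro iffI allI impI, goal_cases)
    case (1 H)
    with sub[of H] split[of H] show ?case by auto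
  next
    case (2 T)
    then have ind: "induced_subgraph (G \<restriction> T) G" by (auto intro: induced_induce)
    with 2 have "\<exists>A. A \<noteq> {} \<and> splitting_stable_set (G \<restriction> T) A" by simp
    with split[OF ind] show ?case by simp
  qed
  finally show ?thesis
    using is_zykov_graph_iff_embedding[OF nomulti_digraph assms(2)] by simp
qed

end
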